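(* Let $n\ge 3$, $t\in(0,2)$, $q_1,q_2>1$, and let $l\in[1,n/2)$ be an integer. Consider the system $$(-\Delta)^l u=|x|^{-t}v^{q_2},\qquad (-\Delta)^l v=|x|^{-t}u^{q_1},\qquad u,v>0 \text{ in }\mathbb{R}^n,$$ and the scaling transformation $u_\mu(x)=\mu^{\sigma_1}u(\mu x)$, $v_\mu(x)=\mu^{\sigma_2}v(\mu x)$, $\mu>0$. The system and the energy functionals $\big\||x|^{-t/(q_1+1)}u\big\|_{L^{q_1+1}(\mathbb{R}^n)}$ and $\big\||x|^{-t/(q_2+1)}v\big\|_{L^{q_2+1}(\mathbb{R}^n)}$ are invariant under the scaling transformation (for some real exponents $\sigma_1,\sigma_2$) if and only if $$\frac{1}{q_1+1}+\frac{1}{q_2+1}=\frac{n-2l}{n-t}.$$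
   Context: Invariance of the system means: for every $\mu>0$ and all positive sufficiently smooth functions $u,v$, the pair $(u_\mu,v_\mu)$ satisfies the two equations at a point $x\neq0$ exactly when $(u,v)$ satisfies them at the point $\mu x$. Invariance of the energy functionals means that, for every $\mu>0$ and all positive $u,v$, their values at $(u_\mu,v_\mu)$ equal their values at $(u,v)$. The same exponents $\sigma_1,\sigma_2$ (independent of $\mu,u,v$) are used for the system and for both energies. *)

theory Defs
  imports "HOL-Analysis.Analysis"
begin

definition partial_deriv :: "'n \<Rightarrow> (real ^ 'n \<Rightarrow> real) \<Rightarrow> real ^ 'n \<Rightarrow> real"
  where "partial_deriv i f x = deriv (\<lambda>s. f (x + s *\<^sub>R axis i 1)) 0"

definition laplacian :: "(real ^ 'n \<Rightarrow> real) \<Rightarrow> real ^ 'n \<Rightarrow> real"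
  where "laplacian f x = (\<Sum>i\<in>UNIV. partial_deriv i (partial_deriv i f) x)"

definition neg_laplacian_pow :: "nat \<Rightarrow> (real ^ 'n \<Rightarrow> real) \<Rightarrow> real ^ 'n \<Rightarrow> real"
  where "neg_laplacian_pow l = (\<lambda>f x. - laplacian f x) ^^ l"

text \<open>The class \<open>C\<^sup>k(S)\<close>, meant for open \<open>S\<close>: all partial derivatives of order at most \<open>k\<close>
  exist and are continuous on \<open>S\<close>.\<close>

primrec Ck_on :: "nat \<Rightarrow> (real ^ 'n) set \<Rightarrow> (real ^ 'n \<Rightarrow> real) \<Rightarrow> bool"
  where
    "Ck_on 0 S f \<longleftrightarrow> continuous_on S f"
  | "Ck_on (Suc k) S f \<longleftrightarrow> continuous_on S f \<and>
       (\<forall>i. (\<forall>x\<in>S. (\<lambda>s. f (x + s *\<^sub>R axis i 1)) differentiable (at 0)) \<and>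
            Ck_on k S (partial_deriv i f))"

text \<open>The \<open>L\<^sup>p\<close> norm, for \<open>0 < p < \<infinity>\<close>, with value \<open>\<infinity>\<close> for measurable functions outside \<open>L\<^sup>p\<close>.\<close>

definition Lp_norm :: "real \<Rightarrow> (real ^ 'n \<Rightarrow> real) \<Rightarrow> ennreal"
  where "Lp_norm p f =
    (let I = (\<integral>\<^sup>+ x. ennreal (\<bar>f x\<bar> powr p) \<partial>lebesgue)
     in if I = \<infinity> then \<infinity> else ennreal (enn2real I powr (1 / p)))"

definition scaling :: "real \<Rightarrow> real \<Rightarrow> (real ^ 'n \<Rightarrow> real) \<Rightarrow> real ^ 'n \<Rightarrow> real"
  where "scaling \<sigma> \<mu> u x = \<mu> powr \<sigma> * u (\<mu> *\<^sub>R x)"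

definition system_at ::
    "nat \<Rightarrow> real \<Rightarrow> real \<Rightarrow> real \<Rightarrow> (real ^ 'n \<Rightarrow> real) \<Rightarrow> (real ^ 'n \<Rightarrow> real) \<Rightarrow> real ^ 'n \<Rightarrow> bool"
  where "system_at l t q\<^sub>1 q\<^sub>2 u v x \<longleftrightarrow>
    neg_laplacian_pow l u x = norm x powr (- t) * v x powr q\<^sub>2 \<and>
    neg_laplacian_pow l v x = norm x powr (- t) * u x powr q\<^sub>1"

definition energy :: "real \<Rightarrow> real \<Rightarrow> (real ^ 'n \<Rightarrow> real) \<Rightarrow> ennreal"
  where "energy t q u = Lp_norm (q + 1) (\<lambda>x. norm x powr (- t / (q + 1)) * u x)"

text \<open>The admissible functions are of class \<open>C\<^sup>2\<^sup>l\<close> away from the origin only: because of the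
  weight \<open>|x|\<^sup>-\<^sup>t\<close>, positive solutions of the system that are continuous at the origin are not
  of class \<open>C\<^sup>2\<^sup>l\<close> there. The type argument fixes the dimension of the space.\<close>

definition system_invariant ::
    "'n::finite itself \<Rightarrow> nat \<Rightarrow> real \<Rightarrow> real \<Rightarrow> real \<Rightarrow> real \<Rightarrow> real \<Rightarrow> bool"
  where "system_invariant _ l t q\<^sub>1 q\<^sub>2 \<sigma>\<^sub>1 \<sigma>\<^sub>2 \<longleftrightarrow>
    (\<forall>\<mu>>0. \<forall>(u :: real ^ 'n \<Rightarrow> real) (v :: real ^ 'n \<Rightarrow> real).
       (\<forall>x. 0 < u x) \<and> (\<forall>x. 0 < v x) \<and> Ck_on (2 * l) (- {0}) u \<and> Ck_on (2 * l) (- {0}) v \<longrightarrow>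
       (\<forall>x. x \<noteq> 0 \<longrightarrow>
          (system_at l t q\<^sub>1 q\<^sub>2 (scaling \<sigma>\<^sub>1 \<mu> u) (scaling \<sigma>\<^sub>2 \<mu> v) x \<longleftrightarrow>
           system_at l t q\<^sub>1 q\<^sub>2 u v (\<mu> *\<^sub>R x))))"

definition energies_invariant ::
    "'n::finite itself \<Rightarrow> real \<Rightarrow> real \<Rightarrow> real \<Rightarrow> real \<Rightarrow> real \<Rightarrow> bool"
  where "energies_invariant _ t q\<^sub>1 q\<^sub>2 \<sigma>\<^sub>1 \<sigma>\<^sub>2 \<longleftrightarrow>
    (\<forall>\<mu>>0. \<forall>(u :: real ^ 'n \<Rightarrow> real) (v :: real ^ 'n \<Rightarrow> real).
       (\<forall>x. 0 < u x) \<and> (\<forall>x. 0 < v x) \<and>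
       u \<in> borel_measurable lebesgue \<and> v \<in> borel_measurable lebesgue \<longrightarrow>
       energy t q\<^sub>1 (scaling \<sigma>\<^sub>1 \<mu> u) = energy t q\<^sub>1 u \<and>
       energy t q\<^sub>2 (scaling \<sigma>\<^sub>2 \<mu> v) = energy t q\<^sub>2 v)"

end

theory Submission
  imports Defs
begin

text \<open>Away from the origin \<open>(-\<Delta>)\<^sup>l u\<^sub>\<mu>(x) = \<mu>\<^bsup>\<sigma>+2l\<^esup> ((-\<Delta>)\<^sup>l u)(\<mu>x)\<close>, so the system is invariant iff
  \<open>\<sigma>\<^sub>1 + 2l = t + \<sigma>\<^sub>2 q\<^sub>2\<close> and \<open>\<sigma>\<^sub>2 + 2l = t + \<sigma>\<^sub>1 q\<^sub>1\<close>. The energy of \<open>u\<^sub>\<mu>\<close> is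
  \<open>\<mu>\<^bsup>\<sigma>-(n-t)/(q+1)\<^esup>\<close> times that of \<open>u\<close>, which forces \<open>\<sigma>\<^sub>i = (n-t)/(q\<^sub>i+1)\<close>, that is
  \<open>\<sigma>\<^sub>i q\<^sub>i = n - t - \<sigma>\<^sub>i\<close>. With these values both equations become \<open>\<sigma>\<^sub>1 + \<sigma>\<^sub>2 = n - 2l\<close>, which is
  the stated condition multiplied by \<open>n - t\<close>.\<close>

section \<open>Locality of derivatives and closure properties of the class C^k\<close>

lemma DERIV_partial_deriv:
  assumes "(\<lambda>s. f (x + s *\<^sub>R axis i 1)) differentiable (at 0)"
  shows "((\<lambda>s. f (x + s *\<^sub>R axis i 1)) has_real_derivative partial_deriv i f x) (at 0)"
  using assms unfolding partial_deriv_def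
  by (simp add: DERIV_deriv_iff_real_differentiable)

lemma eventually_line_in_open:
  fixes S :: "(real ^ 'n) set"
  assumes "open S" "x \<in> S"
  shows "\<forall>\<^sub>F s in nhds (0::real). x + s *\<^sub>R axis i 1 \<in> S"
proof -
  have "((\<lambda>s::real. x + s *\<^sub>R axis i 1) \<longlongrightarrow> x + 0 *\<^sub>R axis i 1) (nhds 0)"
    by (intro tendsto_intros filterlim_ident)
  then have "filterlim (\<lambda>s::real. x + s *\<^sub>R axis i 1) (nhds x) (nhds 0)"
    by simp
  moreover have "\<forall>\<^sub>F y in nhds x. y \<in> S"
    using assms by (rule eventually_nhds_in_open)
  ultimately show ?thesis
    unfolding filterlim_iff by blast
qed

text \<open>Near parameter 0 the coordinate line through \<open>x\<close> stays in the open set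
  \<open>S\<close>, and \<open>deriv\<close> at 0 sees only that part. Locality matters because the
  identities for scaled functions are available only off the origin.\<close>

lemma partial_deriv_cong_open:
  fixes f g :: "real ^ 'n \<Rightarrow> real"
  assumes "open S" "x \<in> S" "\<And>y. y \<in> S \<Longrightarrow> f y = g y"
  shows "partial_deriv i f x = partial_deriv i g x"
  unfolding partial_deriv_def
  by (rule deriv_cong_ev)
     (auto intro: eventually_mono[OF eventually_line_in_open[OF assms(1,2)]] assms(3))

lemma laplacian_cong_open:
  fixes f g :: "real ^ 'n \<Rightarrow> real"
  assumes "open S" "x \<in> S" "\<And>y. y \<in> S \<Longrightarrow> f y = g y"
  shows "laplacian f x = laplacian g x"
  unfolding laplacian_def
  by (intro sum.cong refl partial_deriv_cong_open[OF assms(1,2)]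
        partial_deriv_cong_open[OF assms(1)] assms(3))

text \<open>Peeling off the innermost Laplacian, rather than the outermost as in
  \<open>funpow\<close>, suits inductions with the function arbitrary: the induction hypothesis is
  applied to \<open>- laplacian f\<close>.\<close>

lemma neg_laplacian_pow_Suc:
  "neg_laplacian_pow (Suc l) f = neg_laplacian_pow l (\<lambda>x. - laplacian f x)"
  unfolding neg_laplacian_pow_def by (simp add: funpow_Suc_right del: funpow.simps)

lemma neg_laplacian_pow_cong_open:
  fixes f g :: "real ^ 'n \<Rightarrow> real"
  assumes "open S" "x \<in> S" "\<And>y. y \<in> S \<Longrightarrow> f y = g y"
  shows "neg_laplacian_pow l f x = neg_laplacian_pow l g x"
  using assms(3)
proof (induction l arbitrary: f g)
  case 0
  then show ?case
    using assms(2) by (simp add: neg_laplacian_pow_def)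
next
  case (Suc l)
  show ?case
    unfolding neg_laplacian_pow_Suc
    by (rule Suc.IH) (simp add: laplacian_cong_open[OF assms(1) _ Suc.prems])
qed

text \<open>The usual differentiation rules identify the partial derivatives of a sum or a negative
  only on \<open>S\<close>; this lemma transfers smoothness across such partial identities.\<close>

lemma Ck_on_cong_open:
  fixes f g :: "real ^ 'n \<Rightarrow> real"
  assumes "open S" "Ck_on k S f" "\<And>y. y \<in> S \<Longrightarrow> f y = g y"
  shows "Ck_on k S g"
  using assms(2,3)
proof (induction k arbitrary: f g)
  case 0
  then show ?case
    using continuous_on_cong[of S S f g] by simp
next
  case (Suc k)
  have "(\<lambda>s. g (x + s *\<^sub>R axis i 1)) differentiable (at 0)" if "x \<in> S" for x i
  proof -
    have "((\<lambda>s. f (x + s *\<^sub>R axis i 1)) has_real_derivative partial_deriv i f x) (at 0)"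
      using Suc.prems(1) that by (intro DERIV_partial_deriv) auto
    then have "((\<lambda>s. g (x + s *\<^sub>R axis i 1)) has_real_derivative partial_deriv i f x) (at 0)"
      using that
      by (subst DERIV_cong_ev[OF refl _ refl, symmetric])
         (auto intro: eventually_mono[OF eventually_line_in_open[OF assms(1) that]] Suc.prems(2))
    then show ?thesis
      using real_differentiable_def by blast
  qed
  moreover have "Ck_on k S (partial_deriv i g)" for i
  proof (rule Suc.IH)
    show "Ck_on k S (partial_deriv i f)"
      using Suc.prems(1) by simp
    show "partial_deriv i f y = partial_deriv i g y" if "y \<in> S" for y
      using assms(1) that Suc.prems(2) by (rule partial_deriv_cong_open)
  qed
  moreover have "continuous_on S g"
    using Suc.prems continuous_on_cong[of S S f g] by simp
  ultimately show ?case
    by simp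
qed

lemma Ck_on_add:
  fixes f g :: "real ^ 'n \<Rightarrow> real"
  assumes "open S" "Ck_on k S f" "Ck_on k S g"
  shows "Ck_on k S (\<lambda>x. f x + g x)"
  using assms(2,3)
proof (induction k arbitrary: f g)
  case 0
  then show ?case by (auto intro: continuous_intros)
next
  case (Suc k)
  have *: "((\<lambda>s. f (x + s *\<^sub>R axis i 1) + g (x + s *\<^sub>R axis i 1)) has_real_derivative
      partial_deriv i f x + partial_deriv i g x) (at 0)" if "x \<in> S" for x i
    using Suc.prems that by (intro DERIV_add DERIV_partial_deriv) auto
  have "Ck_on k S (\<lambda>x. partial_deriv i f x + partial_deriv i g x)" for i
    using Suc.prems by (intro Suc.IH) auto
  then have "Ck_on k S (partial_deriv i (\<lambda>x. f x + g x))" for i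
    by (rule Ck_on_cong_open[OF assms(1)])
       (simp add: partial_deriv_def[of i "\<lambda>x. f x + g x"] DERIV_imp_deriv[OF *])
  moreover have "(\<lambda>s. f (x + s *\<^sub>R axis i 1) + g (x + s *\<^sub>R axis i 1)) differentiable (at 0)"
    if "x \<in> S" for x i
    using *[OF that] real_differentiable_def by blast
  ultimately show ?case
    using Suc.prems by (auto intro: continuous_intros)
qed

lemma Ck_on_minus:
  fixes f :: "real ^ 'n \<Rightarrow> real"
  assumes "open S" "Ck_on k S f"
  shows "Ck_on k S (\<lambda>x. - f x)"
  using assms(2)
proof (induction k arbitrary: f)
  case 0
  then show ?case by (auto intro: continuous_intros)
next
  case (Suc k)
  have *: "((\<lambda>s. - f (x + s *\<^sub>R axis i 1)) has_real_derivative - partial_deriv i f x) (at 0)"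
    if "x \<in> S" for x i
    using Suc.prems that by (intro DERIV_minus DERIV_partial_deriv) auto
  have "Ck_on k S (\<lambda>x. - partial_deriv i f x)" for i
    using Suc.prems by (intro Suc.IH) auto
  then have "Ck_on k S (partial_deriv i (\<lambda>x. - f x))" for i
    by (rule Ck_on_cong_open[OF assms(1)])
       (simp add: partial_deriv_def[of i "\<lambda>x. - f x"] DERIV_imp_deriv[OF *])
  moreover have "(\<lambda>s. - f (x + s *\<^sub>R axis i 1)) differentiable (at 0)" if "x \<in> S" for x i
    using *[OF that] real_differentiable_def by blast
  ultimately show ?case
    using Suc.prems by (auto intro: continuous_intros)
qed

section \<open>Cosines of one coordinate, and Laplacians of C^k functions\<close>

text \<open>Writing \<open>- sin\<close> as a cosine shifted by \<open>pi / 2\<close>, and keeping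
  the summand 0, puts the derivative back into the family
  \<open>a + b * cos (w * x $ i + c)\<close>. Smoothness of every order then follows by a plain
  induction with \<open>a\<close>, \<open>b\<close>, \<open>c\<close> arbitrary.\<close>

lemma DERIV_cos_coord:
  fixes x :: "real ^ 'n"
  shows "((\<lambda>s. a + b * cos (w * (x + s *\<^sub>R axis j 1) $ i + c)) has_real_derivative
      0 + (if j = i then b * w else 0) * cos (w * x $ i + (c + pi / 2))) (at 0)"
proof -
  have "cos (w * x $ i + (c + pi / 2)) = - sin (w * x $ i + c)"
    using minus_sin_cos_eq[of "w * x $ i + c"] by (simp add: add.assoc)
  then show ?thesis
    by (auto intro!: derivative_eq_intros simp: axis_def)
qed

lemma partial_deriv_cos_coord:
  "partial_deriv j (\<lambda>x::real^'n. a + b * cos (w * x $ i + c)) =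
    (\<lambda>x. 0 + (if j = i then b * w else 0) * cos (w * x $ i + (c + pi / 2)))"
  unfolding partial_deriv_def by (intro ext DERIV_imp_deriv DERIV_cos_coord)

lemma Ck_on_cos_coord:
  fixes S :: "(real ^ 'n) set"
  shows "Ck_on k S (\<lambda>x. a + b * cos (w * x $ i + c))"
proof (induction k arbitrary: a b c)
  case 0
  show ?case by (auto intro!: continuous_intros)
next
  case (Suc k)
  have "Ck_on k S (partial_deriv j (\<lambda>x. a + b * cos (w * x $ i + c)))" for j
    unfolding partial_deriv_cos_coord by (rule Suc.IH)
  moreover have "(\<lambda>s. a + b * cos (w * (x + s *\<^sub>R axis j 1) $ i + c)) differentiable (at 0)"
    for x :: "real ^ 'n" and j
    using DERIV_cos_coord real_differentiable_def by blast
  ultimately show ?case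
    by (auto intro!: continuous_intros)
qed

lemma Ck_on_sum:
  fixes f :: "'i \<Rightarrow> real ^ 'n \<Rightarrow> real"
  assumes "open S" "finite I" "\<And>i. i \<in> I \<Longrightarrow> Ck_on k S (f i)"
  shows "Ck_on k S (\<lambda>x. \<Sum>i\<in>I. f i x)"
  using assms(2,3)
proof (induction I)
  case empty
  \<comment> \<open>The empty sum is the zero function, a member of the cosine family with all
    coefficients 0; the coordinate index is arbitrary.\<close>
  show ?case
    using Ck_on_cos_coord[of k S 0 0 0 undefined 0] by simp
next
  case (insert i I)
  then show ?case
    using Ck_on_add[OF assms(1), of k "f i" "\<lambda>x. \<Sum>i\<in>I. f i x"] by simp
qed

lemma Ck_on_neg_laplacian:
  fixes f :: "real ^ 'n \<Rightarrow> real"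
  assumes "open S" "Ck_on (Suc (Suc k)) S f"
  shows "Ck_on k S (\<lambda>x. - laplacian f x)"
  unfolding laplacian_def
  using assms by (intro Ck_on_minus Ck_on_sum) auto

text \<open>The cosine is an eigenfunction of -\<Delta> with eigenvalue \<open>w\<^sup>2\<close>,
  and the constant \<open>a\<close> is annihilated. The summand 0 again keeps the result inside the
  family.\<close>

lemma neg_laplacian_cos_coord:
  "(\<lambda>x. - laplacian (\<lambda>x::real^'n. a + b * cos (w * x $ i + c)) x) =
    (\<lambda>x. 0 + (b * w\<^sup>2) * cos (w * x $ i + c))"
proof -
  have "partial_deriv j (partial_deriv j (\<lambda>x::real^'n. a + b * cos (w * x $ i + c))) x =
      (if j = i then - (b * w\<^sup>2) * cos (w * x $ i + c) else 0)" for j x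
    unfolding partial_deriv_cos_coord
    by (simp add: cos_add sin_add power2_eq_square algebra_simps)
  then show ?thesis
    by (simp add: laplacian_def)
qed

text \<open>The power is a successor because at least one Laplacian must act to remove the constant
  \<open>a\<close>.\<close>

lemma neg_laplacian_pow_cos_coord:
  "neg_laplacian_pow (Suc l) (\<lambda>x::real^'n. a + b * cos (w * x $ i + c)) x =
    b * w ^ (2 * Suc l) * cos (w * x $ i + c)"
proof (induction l arbitrary: a b)
  case 0
  show ?case
    unfolding neg_laplacian_pow_Suc neg_laplacian_cos_coord
    by (simp add: neg_laplacian_pow_def)
next
  case (Suc l)
  show ?case
    unfolding neg_laplacian_pow_Suc[of "Suc l"] neg_laplacian_cos_coord Suc.IH
    by (simp add: power2_eq_square)
qed

section \<open>Effect of the scaling on both sides of the equations\<close>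

text \<open>The chain rule produces one factor \<mu>, which is absorbed by raising the scaling
  exponent by 1. The derivative is thus again a scaled function, so the rule can be
  iterated.\<close>

lemma partial_deriv_scaling:
  fixes f :: "real ^ 'n \<Rightarrow> real"
  assumes "0 < \<mu>" "(\<lambda>s. f (\<mu> *\<^sub>R x + s *\<^sub>R axis i 1)) differentiable (at 0)"
  shows "partial_deriv i (scaling \<sigma> \<mu> f) x = scaling (\<sigma> + 1) \<mu> (partial_deriv i f) x"
proof -
  have "((\<lambda>s. f (\<mu> *\<^sub>R x + s *\<^sub>R axis i 1)) has_real_derivative partial_deriv i f (\<mu> *\<^sub>R x))
      (at (\<mu> * 0))"
    using DERIV_partial_deriv[OF assms(2)] by simp
  then have "((\<lambda>s. f (\<mu> *\<^sub>R x + (\<mu> * s) *\<^sub>R axis i 1)) has_real_derivative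
      partial_deriv i f (\<mu> *\<^sub>R x) * \<mu>) (at 0)"
    by (rule DERIV_chain2) (auto intro!: derivative_eq_intros)
  then have "((\<lambda>s. \<mu> powr \<sigma> * f (\<mu> *\<^sub>R x + (\<mu> * s) *\<^sub>R axis i 1)) has_real_derivative
      \<mu> powr \<sigma> * (partial_deriv i f (\<mu> *\<^sub>R x) * \<mu>)) (at 0)"
    by (rule DERIV_cmult)
  then show ?thesis
    using assms(1)
    by (simp add: partial_deriv_def[of i "scaling \<sigma> \<mu> f"] scaling_def DERIV_imp_deriv
        powr_add scaleR_add_right)
qed

lemma neg_laplacian_scaling:
  fixes f :: "real ^ 'n \<Rightarrow> real"
  assumes "0 < \<mu>" "Ck_on (Suc (Suc k)) (- {0}) f" "x \<noteq> 0"
  shows "- laplacian (scaling \<sigma> \<mu> f) x = scaling (\<sigma> + 2) \<mu> (\<lambda>x. - laplacian f x) x"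
proof -
  have "partial_deriv i (partial_deriv i (scaling \<sigma> \<mu> f)) x =
      scaling (\<sigma> + 2) \<mu> (partial_deriv i (partial_deriv i f)) x" for i
  proof -
    have "partial_deriv i (scaling \<sigma> \<mu> f) y = scaling (\<sigma> + 1) \<mu> (partial_deriv i f) y"
      if "y \<in> - {0}" for y
      using assms(1,2) that by (intro partial_deriv_scaling) auto
    \<comment> \<open>The formula for the inner derivative holds on the punctured space, which is
      open, so it may be differentiated at \<open>x\<close>.\<close>
    then have "partial_deriv i (partial_deriv i (scaling \<sigma> \<mu> f)) x =
        partial_deriv i (scaling (\<sigma> + 1) \<mu> (partial_deriv i f)) x"
      using assms(3) by (intro partial_deriv_cong_open[of "- {0}"]) auto
    also have "\<dots> = scaling (\<sigma> + 1 + 1) \<mu> (partial_deriv i (partial_deriv i f)) x"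
      using assms by (intro partial_deriv_scaling) auto
    finally show ?thesis by (simp add: add.assoc)
  qed
  then show ?thesis
    by (simp add: laplacian_def scaling_def sum_distrib_left)
qed

lemma neg_laplacian_pow_scaling:
  fixes f :: "real ^ 'n \<Rightarrow> real"
  assumes "0 < \<mu>" "Ck_on (2 * l) (- {0}) f" "x \<noteq> 0"
  shows "neg_laplacian_pow l (scaling \<sigma> \<mu> f) x =
    \<mu> powr (\<sigma> + 2 * real l) * neg_laplacian_pow l f (\<mu> *\<^sub>R x)"
  using assms(2)
proof (induction l arbitrary: \<sigma> f)
  case 0
  show ?case by (simp add: neg_laplacian_pow_def scaling_def)
next
  case (Suc l)
  then have C: "Ck_on (Suc (Suc (2 * l))) (- {0}) f" by simp
  have "neg_laplacian_pow (Suc l) (scaling \<sigma> \<mu> f) x =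
      neg_laplacian_pow l (scaling (\<sigma> + 2) \<mu> (\<lambda>x. - laplacian f x)) x"
    unfolding neg_laplacian_pow_Suc
    using assms(1,3) C
    by (intro neg_laplacian_pow_cong_open[of "- {0}"] neg_laplacian_scaling) auto
  also have "\<dots> = \<mu> powr (\<sigma> + 2 + 2 * real l) *
      neg_laplacian_pow l (\<lambda>x. - laplacian f x) (\<mu> *\<^sub>R x)"
    using C by (intro Suc.IH Ck_on_neg_laplacian) auto
  finally show ?case
    by (simp add: neg_laplacian_pow_Suc algebra_simps)
qed

text \<open>The weight contributes \<mu> to the power \<open>t\<close>, since
  \<open>norm x = norm (\<mu> *\<^sub>R x) / \<mu>\<close>, and the scaled function contributes the
  power \<open>\<sigma> * q\<close>.\<close>

lemma weighted_power_scaling: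
  fixes x :: "real ^ 'n"
  assumes "0 < \<mu>" "x \<noteq> 0" "0 < v (\<mu> *\<^sub>R x)"
  shows "norm x powr (- t) * scaling \<sigma> \<mu> v x powr q =
    \<mu> powr (t + \<sigma> * q) * (norm (\<mu> *\<^sub>R x) powr (- t) * v (\<mu> *\<^sub>R x) powr q)"
  using assms
  by (simp add: scaling_def powr_mult powr_powr powr_add powr_minus field_simps)

section \<open>Exponents that leave the system invariant\<close>

text \<open>Under these relations the two sides of each equation acquire the same positive power of
  \<mu>, which cancels.\<close>

lemma system_invariant_if:
  assumes "\<sigma>\<^sub>1 + 2 * real l = t + \<sigma>\<^sub>2 * q\<^sub>2" "\<sigma>\<^sub>2 + 2 * real l = t + \<sigma>\<^sub>1 * q\<^sub>1"
  shows "system_invariant TYPE('n::finite) l t q\<^sub>1 q\<^sub>2 \<sigma>\<^sub>1 \<sigma>\<^sub>2"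
  unfolding system_invariant_def system_at_def
proof (intro allI impI, elim conjE)
  fix \<mu> :: real and u v :: "real ^ 'n \<Rightarrow> real" and x :: "real ^ 'n"
  assume *: "0 < \<mu>" "\<forall>x. 0 < u x" "\<forall>x. 0 < v x"
    "Ck_on (2 * l) (- {0}) u" "Ck_on (2 * l) (- {0}) v" "x \<noteq> 0"
  have "neg_laplacian_pow l (scaling \<sigma>\<^sub>1 \<mu> u) x =
      \<mu> powr (t + \<sigma>\<^sub>2 * q\<^sub>2) * neg_laplacian_pow l u (\<mu> *\<^sub>R x)"
    "neg_laplacian_pow l (scaling \<sigma>\<^sub>2 \<mu> v) x =
      \<mu> powr (t + \<sigma>\<^sub>1 * q\<^sub>1) * neg_laplacian_pow l v (\<mu> *\<^sub>R x)"
    using * by (simp_all add: neg_laplacian_pow_scaling flip: assms)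
  moreover have "norm x powr - t * scaling \<sigma>\<^sub>2 \<mu> v x powr q\<^sub>2 =
      \<mu> powr (t + \<sigma>\<^sub>2 * q\<^sub>2) * (norm (\<mu> *\<^sub>R x) powr - t * v (\<mu> *\<^sub>R x) powr q\<^sub>2)"
    "norm x powr - t * scaling \<sigma>\<^sub>1 \<mu> u x powr q\<^sub>1 =
      \<mu> powr (t + \<sigma>\<^sub>1 * q\<^sub>1) * (norm (\<mu> *\<^sub>R x) powr - t * u (\<mu> *\<^sub>R x) powr q\<^sub>1)"
    using * by (blast intro: weighted_power_scaling)+
  ultimately show "(neg_laplacian_pow l (scaling \<sigma>\<^sub>1 \<mu> u) x =
        norm x powr - t * scaling \<sigma>\<^sub>2 \<mu> v x powr q\<^sub>2 \<and>
      neg_laplacian_pow l (scaling \<sigma>\<^sub>2 \<mu> v) x =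
        norm x powr - t * scaling \<sigma>\<^sub>1 \<mu> u x powr q\<^sub>1) \<longleftrightarrow>
    (neg_laplacian_pow l u (\<mu> *\<^sub>R x) = norm (\<mu> *\<^sub>R x) powr - t * v (\<mu> *\<^sub>R x) powr q\<^sub>2 \<and>
      neg_laplacian_pow l v (\<mu> *\<^sub>R x) = norm (\<mu> *\<^sub>R x) powr - t * u (\<mu> *\<^sub>R x) powr q\<^sub>1)"
    using *(1) by simp
qed

text \<open>Since the equations are compared pointwise, it suffices to test invariance on functions
  that solve the system at a single point: \<open>2 + cos (w (x\<^sub>i - 1))\<close> with a suitable frequency \<open>w\<close>
  does so at the \<open>i\<close>-th unit vector.\<close>

lemma system_invariant_imp:
  assumes "system_invariant TYPE('n::finite) l t q\<^sub>1 q\<^sub>2 \<sigma>\<^sub>1 \<sigma>\<^sub>2" "1 \<le> l"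
  shows "\<sigma>\<^sub>1 + 2 * real l = t + \<sigma>\<^sub>2 * q\<^sub>2"
proof -
  fix i :: 'n
  \<comment> \<open>The frequency \<open>w = 3 powr (q / (2 * real l))\<close> satisfies
    \<open>w ^ (2 * l) = 3 powr q\<close>. At the unit vector \<open>e\<close> the cosine equals 1,
    so the function has value 3 and its iterated Laplacian has value
    \<open>3 powr q\<close>.\<close>
  define f where "f q = (\<lambda>x::real^'n. 2 + 1 * cos (3 powr (q / (2 * real l)) * x $ i
    + - (3 powr (q / (2 * real l)))))" for q :: real
  define e where "e = (axis i 1 :: real ^ 'n)"
  define x where "x = (1 / 2) *\<^sub>R e"
  have pos: "0 < f q y" for q y
    unfolding f_def using cos_ge_minus_one[of "3 powr (q / (2 * real l)) * y $ i
      + - (3 powr (q / (2 * real l)))"] by linarith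
  have Ck: "Ck_on (2 * l) (- {0}) (f q)" for q
    unfolding f_def by (rule Ck_on_cos_coord)
  have val: "f q e = 3" for q
    by (simp add: f_def e_def)
  have lap: "neg_laplacian_pow l (f q) e = 3 powr q" for q
  proof -
    obtain m where m: "l = Suc m"
      using assms(2) by (cases l) auto
    have "neg_laplacian_pow l (f q) e = (3 powr (q / (2 * real l))) ^ (2 * l)"
      unfolding f_def m neg_laplacian_pow_cos_coord by (simp add: e_def)
    also have "\<dots> = 3 powr q"
      using assms(2) by (simp add: powr_realpow[symmetric] powr_powr)
    finally show ?thesis .
  qed
  have e: "norm e = 1" "e \<noteq> 0" "x \<noteq> 0" "2 *\<^sub>R x = e"
    by (auto simp: e_def x_def)
  \<comment> \<open>The exponents are crossed: the first function carries frequency parameter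
    \<open>q\<^sub>2\<close> because its Laplacian must match the power \<open>q\<^sub>2\<close> of
    the second, and vice versa. The weight is 1 at \<open>e\<close>.\<close>
  have "system_at l t q\<^sub>1 q\<^sub>2 (f q\<^sub>2) (f q\<^sub>1) e"
    by (simp add: system_at_def lap val e)
  then have "system_at l t q\<^sub>1 q\<^sub>2 (scaling \<sigma>\<^sub>1 2 (f q\<^sub>2)) (scaling \<sigma>\<^sub>2 2 (f q\<^sub>1)) x"
    using assms(1)[unfolded system_invariant_def, rule_format, of 2 "f q\<^sub>2" "f q\<^sub>1" x] pos Ck e by simp
  then have "neg_laplacian_pow l (scaling \<sigma>\<^sub>1 2 (f q\<^sub>2)) x =
      norm x powr (- t) * scaling \<sigma>\<^sub>2 2 (f q\<^sub>1) x powr q\<^sub>2"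
    by (simp add: system_at_def)
  \<comment> \<open>With \<mu> = 2 and \<open>x\<close> half of \<open>e\<close>, all values are
    taken at \<open>e\<close>. The nonzero factor \<open>3 powr q\<^sub>2\<close> then cancels and
    the exponents of 2 can be compared.\<close>
  then have "2 powr (\<sigma>\<^sub>1 + 2 * real l) * 3 powr q\<^sub>2 = 2 powr (t + \<sigma>\<^sub>2 * q\<^sub>2) * 3 powr q\<^sub>2"
    using weighted_power_scaling[of 2 x "f q\<^sub>1" t \<sigma>\<^sub>2 q\<^sub>2] pos e
    by (simp add: neg_laplacian_pow_scaling Ck lap val)
  then show ?thesis
    by (simp add: powr_inj)
qed

section \<open>Scaling of the energies and the exponents that preserve them\<close>

lemma nn_integral_lebesgue_scaleR:
  fixes f :: "'a::euclidean_space \<Rightarrow> ennreal"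
  assumes [measurable]: "f \<in> borel_measurable lebesgue" and "c \<noteq> 0"
  shows "(\<integral>\<^sup>+x. f x \<partial>lebesgue) = ennreal (\<bar>c\<bar> ^ DIM('a)) * (\<integral>\<^sup>+x. f (c *\<^sub>R x) \<partial>lebesgue)"
proof -
  \<comment> \<open>This is the affine map of \<open>lebesgue_affine_euclidean\<close> with every
    coordinate factor equal to \<open>c\<close> and no translation.\<close>
  have T: "(\<lambda>x::'a. 0 + (\<Sum>j\<in>Basis. (c * (x \<bullet> j)) *\<^sub>R j)) = (*\<^sub>R) c"
  proof
    fix x :: 'a
    have "0 + (\<Sum>j\<in>Basis. (c * (x \<bullet> j)) *\<^sub>R j) = c *\<^sub>R (\<Sum>j\<in>Basis. (x \<bullet> j) *\<^sub>R j)"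
      by (simp only: scaleR_sum_right scaleR_scaleR add_0_left)
    then show "0 + (\<Sum>j\<in>Basis. (c * (x \<bullet> j)) *\<^sub>R j) = c *\<^sub>R x"
      by (simp only: euclidean_representation)
  qed
  have "lebesgue = density (distr lebesgue lebesgue ((*\<^sub>R) c)) (\<lambda>_::'a. ennreal (\<Prod>j\<in>(Basis::'a set). \<bar>c\<bar>))"
    using lebesgue_affine_euclidean[of "\<lambda>_. c" "0::'a", unfolded T] assms(2) by blast
  from arg_cong[OF this, of "\<lambda>M. integral\<^sup>N M f"]
  have "(\<integral>\<^sup>+x. f x \<partial>lebesgue) = (\<integral>\<^sup>+x. f x
      \<partial>density (distr lebesgue lebesgue ((*\<^sub>R) c)) (\<lambda>_::'a. ennreal (\<bar>c\<bar> ^ DIM('a))))"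
    by (simp only: prod_constant)
  also have "\<dots> = ennreal (\<bar>c\<bar> ^ DIM('a)) * (\<integral>\<^sup>+x. f (c *\<^sub>R x) \<partial>lebesgue)"
    by (simp add: nn_integral_density nn_integral_cmult nn_integral_distr)
  finally show ?thesis .
qed

text \<open>With \<open>p = q + 1\<close>, substituting \<open>\<mu> *\<^sub>R x\<close> multiplies
  the integral by \<mu> to the power \<open>\<sigma> * p + t - n\<close>, where \<open>n\<close> is
  the dimension; the p-th root divides this exponent by \<open>p\<close>.\<close>

lemma energy_scaling:
  fixes u :: "real ^ 'n \<Rightarrow> real"
  assumes \<mu>: "0 < \<mu>" and q: "0 < q + 1" and pos: "\<And>x. 0 < u x"
    and [measurable]: "u \<in> borel_measurable lebesgue"
  shows "energy t q (scaling \<sigma> \<mu> u) =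
    ennreal (\<mu> powr (\<sigma> - (real CARD('n) - t) / (q + 1))) * energy t q u"
proof -
  define p where "p = q + 1"
  have p: "p > 0" using q by (simp add: p_def)
  define F where "F = (\<lambda>x. ennreal (\<bar>norm x powr (- t / p) * u x\<bar> powr p))"
  define I where "I = (\<integral>\<^sup>+x. F x \<partial>lebesgue)"
  define c where "c = \<mu> powr (\<sigma> * p + t - real CARD('n))"
  have c: "c > 0" using \<mu> by (simp add: c_def)
  have [measurable]: "norm \<in> borel_measurable (lebesgue :: (real ^ 'n) measure)"
    by (intro measurable_completion) simp
  have F[measurable]: "F \<in> borel_measurable lebesgue"
    unfolding F_def by measurable
  have pt: "ennreal (\<bar>norm x powr (- t / p) * scaling \<sigma> \<mu> u x\<bar> powr p) =
      ennreal (\<mu> powr (\<sigma> * p + t)) * F (\<mu> *\<^sub>R x)" for x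
  proof -
    \<comment> \<open>The power \<open>p\<close> turns the weight into \<open>r powr (- t)\<close>.
      This includes \<open>r = 0\<close>, where \<open>powr\<close> has value 0 on both
      sides.\<close>
    have pow: "\<bar>r powr (- t / p) * s\<bar> powr p = r powr (- t) * s powr p" if "0 < s" for r s :: real
      using p that by (simp add: abs_mult powr_mult powr_powr)
    have "\<bar>norm x powr (- t / p) * scaling \<sigma> \<mu> u x\<bar> powr p =
        \<mu> powr (\<sigma> * p + t) * \<bar>norm (\<mu> *\<^sub>R x) powr (- t / p) * u (\<mu> *\<^sub>R x)\<bar> powr p"
      using \<mu> pos[of "\<mu> *\<^sub>R x"]
      unfolding scaling_def by (subst (1 2) pow) (simp_all add: powr_mult powr_powr powr_add powr_minus)
    then show ?thesis
      unfolding F_def by (simp add: ennreal_mult')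
  qed
  have "(\<integral>\<^sup>+x. F (\<mu> *\<^sub>R x) \<partial>lebesgue) = ennreal (\<mu> powr - real CARD('n)) * I"
  proof -
    have "I = ennreal (\<mu> ^ CARD('n)) * (\<integral>\<^sup>+x. F (\<mu> *\<^sub>R x) \<partial>lebesgue)"
      unfolding I_def using nn_integral_lebesgue_scaleR[OF F, of \<mu>] \<mu> by simp
    then show ?thesis
      using \<mu> by (simp add: mult.assoc[symmetric] ennreal_mult[symmetric] powr_minus powr_realpow)
  qed
  then have I': "(\<integral>\<^sup>+x. ennreal (\<bar>norm x powr (- t / p) * scaling \<sigma> \<mu> u x\<bar> powr p) \<partial>lebesgue) =
      ennreal c * I"
    unfolding pt c_def using \<mu>
    by (simp add: nn_integral_cmult mult.assoc[symmetric] ennreal_mult[symmetric] powr_add[symmetric])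
  have cp: "\<mu> powr (\<sigma> - (real CARD('n) - t) / p) = c powr (1 / p)"
    unfolding c_def powr_powr using p by (simp add: field_simps)
  show ?thesis
  proof (cases "I = \<infinity>")
    \<comment> \<open>An infinite energy stays infinite, as the scaling factor is positive.\<close>
    case True
    then show ?thesis
      using c \<mu>
      unfolding energy_def Lp_norm_def p_def[symmetric] I' F_def[symmetric] I_def[symmetric]
      by (simp add: ennreal_mult_top)
  next
    case False
    then have "ennreal c * I \<noteq> \<infinity>"
      by (simp add: ennreal_mult_eq_top_iff)
    then show ?thesis
      using False c
      unfolding energy_def Lp_norm_def p_def[symmetric] I' F_def[symmetric] I_def[symmetric] cp
      by (simp add: enn2real_mult powr_mult ennreal_mult)
  qed
qed

text \<open>Needed to cancel the energy from the scaling identity. Sigma-finiteness supplies a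
  positive integrable function, and \<open>u\<close> is solved for so that the energy integrand
  equals it off the origin.\<close>

lemma energy_finite_positive_exists:
  assumes q: "0 < q + 1"
  obtains u :: "real ^ 'n \<Rightarrow> real" where "\<And>x. 0 < u x" "u \<in> borel_measurable lebesgue"
    "energy t q u \<noteq> 0" "energy t q u \<noteq> \<infinity>"
proof -
  define p where "p = q + 1"
  have p: "p > 0" using q by (simp add: p_def)
  obtain h :: "real ^ 'n \<Rightarrow> ennreal" where h[measurable]: "h \<in> borel_measurable lborel"
    and hfin: "integral\<^sup>N lborel h \<noteq> \<infinity>" and hpos: "\<And>x. 0 < h x \<and> h x < \<infinity>"
    using sigma_finite_measure.Ex_finite_integrable_function[OF sigma_finite_lborel] by auto
  define g where "g x = enn2real (h x)" for x
  have g: "0 < g x" "ennreal (g x) = h x" for x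
    using hpos[of x] by (auto simp: g_def enn2real_positive_iff)
  \<comment> \<open>The formula would give 0 at the origin, where \<open>u\<close> must still be
    positive; hence the separate value 1.\<close>
  define u where "u x = (if x = 0 then 1 else (norm x powr t * g x) powr (1 / p))" for x
  have um: "u \<in> borel_measurable borel"
    unfolding u_def g_def by measurable
  have upos: "0 < u x" for x
    using g(1)[of x] by (simp add: u_def)
  define F where "F x = \<bar>norm x powr (- t / p) * u x\<bar> powr p" for x
  have [measurable]: "F \<in> borel_measurable borel"
    unfolding F_def using um by measurable
  have F: "F x = (if x = 0 then 0 else g x)" for x
    using g(1)[of x] p
    by (simp add: F_def u_def abs_mult powr_mult powr_powr powr_minus field_simps)
  define I where "I = (\<integral>\<^sup>+x. ennreal (F x) \<partial>lebesgue)"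
  have I: "I = (\<integral>\<^sup>+x. ennreal (F x) \<partial>lborel)"
    unfolding I_def by (rule nn_integral_completion)
  have "I \<le> integral\<^sup>N lborel h"
    unfolding I by (intro nn_integral_mono) (simp add: F g)
  then have fin: "I \<noteq> \<infinity>"
    using hfin by (auto simp: top_unique)
  \<comment> \<open>The integrand vanishes only at the origin, a null set, whereas the whole space
    has infinite measure.\<close>
  have "I \<noteq> 0"
  proof
    assume "I = 0"
    then have "AE x in lborel. ennreal (F x) = 0"
      unfolding I by (subst (asm) nn_integral_0_iff_AE) auto
    moreover have "AE x in lborel. x \<noteq> (0 :: real ^ 'n)"
      by (rule AE_lborel_singleton)
    ultimately have "AE x in (lborel :: (real ^ 'n) measure). False"
    proof eventually_elim
      case (elim x)
      then show False
        using g(1)[of x] by (simp add: F ennreal_eq_0_iff)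
    qed
    then show False
      by (subst (asm) AE_iff_measurable[of UNIV]) (auto simp: emeasure_lborel_UNIV)
  qed
  then have "enn2real I > 0"
    using fin by (simp add: enn2real_positive_iff top.not_eq_extremum zero_less_iff_neq_zero)
  then have "energy t q u \<noteq> 0" "energy t q u \<noteq> \<infinity>"
    unfolding energy_def Lp_norm_def p_def[symmetric] F_def[symmetric] I_def[symmetric]
    using fin by (simp_all add: Let_def)
  then show thesis
    using that[of u] upos um by (simp add: measurable_completion)
qed

text \<open>The stated exponents make the scaling factor 1. Conversely, \<mu> = 2 tested on
  functions of finite nonzero energy forces the power of 2 to be 1, hence its exponent to be
  0.\<close>

lemma energies_invariant_iff:
  assumes "0 < q\<^sub>1 + 1" "0 < q\<^sub>2 + 1"
  shows "energies_invariant TYPE('n::finite) t q\<^sub>1 q\<^sub>2 \<sigma>\<^sub>1 \<sigma>\<^sub>2 \<longleftrightarrow>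
    \<sigma>\<^sub>1 = (real CARD('n) - t) / (q\<^sub>1 + 1) \<and> \<sigma>\<^sub>2 = (real CARD('n) - t) / (q\<^sub>2 + 1)"
    (is "?L \<longleftrightarrow> ?R")
proof
  assume ?R
  then show ?L
    unfolding energies_invariant_def using assms by (auto simp: energy_scaling)
next
  assume ?L
  obtain u :: "real ^ 'n \<Rightarrow> real" where u: "\<And>x. 0 < u x" "u \<in> borel_measurable lebesgue"
    "energy t q\<^sub>1 u \<noteq> 0" "energy t q\<^sub>1 u \<noteq> \<infinity>"
    using energy_finite_positive_exists[OF assms(1)] by blast
  obtain v :: "real ^ 'n \<Rightarrow> real" where v: "\<And>x. 0 < v x" "v \<in> borel_measurable lebesgue"
    "energy t q\<^sub>2 v \<noteq> 0" "energy t q\<^sub>2 v \<noteq> \<infinity>"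
    using energy_finite_positive_exists[OF assms(2)] by blast
  have cancel: "s = 0" if E: "ennreal (2 powr s) * E = E" "E \<noteq> 0" "E \<noteq> \<infinity>" for s :: real and E
  proof -
    obtain r where r: "E = ennreal r" "r > 0"
      using E(2,3) by (cases E) (auto simp: less_le)
    then have "2 powr s * r = r"
      using E(1) by (simp add: ennreal_mult[symmetric])
    then show ?thesis
      using r(2) by simp
  qed
  have "energy t q\<^sub>1 (scaling \<sigma>\<^sub>1 2 u) = energy t q\<^sub>1 u \<and> energy t q\<^sub>2 (scaling \<sigma>\<^sub>2 2 v) = energy t q\<^sub>2 v"
    using \<open>?L\<close>[unfolded energies_invariant_def, rule_format, of 2 u v] u(1,2) v(1,2) by simp
  then have "ennreal (2 powr (\<sigma>\<^sub>1 - (real CARD('n) - t) / (q\<^sub>1 + 1))) * energy t q\<^sub>1 u = energy t q\<^sub>1 u"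
    "ennreal (2 powr (\<sigma>\<^sub>2 - (real CARD('n) - t) / (q\<^sub>2 + 1))) * energy t q\<^sub>2 v = energy t q\<^sub>2 v"
    using u(1,2) v(1,2) assms by (simp_all add: energy_scaling)
  from cancel[OF this(1) u(3,4)] cancel[OF this(2) v(3,4)] show ?R
    by simp
qed

section \<open>Elimination of the scaling exponents\<close>

theorem proposition2p3:
  fixes t q\<^sub>1 q\<^sub>2 :: real and l :: nat
  assumes "CARD('n::finite) \<ge> 3"
    and "0 < t" and "t < 2"
    and "q\<^sub>1 > 1" and "q\<^sub>2 > 1"
    and "1 \<le> l" and "real l < real CARD('n) / 2"
  shows "(\<exists>(\<sigma>\<^sub>1 :: real) (\<sigma>\<^sub>2 :: real).
            system_invariant TYPE('n) l t q\<^sub>1 q\<^sub>2 \<sigma>\<^sub>1 \<sigma>\<^sub>2 \<and>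
            energies_invariant TYPE('n) t q\<^sub>1 q\<^sub>2 \<sigma>\<^sub>1 \<sigma>\<^sub>2) \<longleftrightarrow>
         1 / (q\<^sub>1 + 1) + 1 / (q\<^sub>2 + 1) =
           (real CARD('n) - 2 * real l) / (real CARD('n) - t)"
proof -
  define m where "m = real CARD('n) - t"
  define a b where "a = m / (q\<^sub>1 + 1)" and "b = m / (q\<^sub>2 + 1)"
  have m: "m > 0"
    using assms(1,3) by (simp add: m_def)
  \<comment> \<open>These are \<open>a * (q\<^sub>1 + 1) = m\<close> and
    \<open>b * (q\<^sub>2 + 1) = m\<close>, rearranged to linearize the products in the exponent
    relations.\<close>
  have ab: "a * q\<^sub>1 = m - a" "b * q\<^sub>2 = m - b"
    using assms(4,5) by (simp_all add: a_def b_def field_simps)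
  have inv: "energies_invariant TYPE('n) t q\<^sub>1 q\<^sub>2 \<sigma>\<^sub>1 \<sigma>\<^sub>2 \<longleftrightarrow> \<sigma>\<^sub>1 = a \<and> \<sigma>\<^sub>2 = b" for \<sigma>\<^sub>1 \<sigma>\<^sub>2
    using assms(4,5) by (simp add: energies_invariant_iff a_def b_def m_def)
  \<comment> \<open>By \<open>ab\<close> both exponent relations reduce to the same equation for
    \<open>a + b\<close>, so the single relation from \<open>system_invariant_imp\<close> suffices
    for one direction and the equation returns both for the other.\<close>
  have "system_invariant TYPE('n) l t q\<^sub>1 q\<^sub>2 a b \<longleftrightarrow> a + b = real CARD('n) - 2 * real l"
  proof
    assume "system_invariant TYPE('n) l t q\<^sub>1 q\<^sub>2 a b"
    then have "a + 2 * real l = t + b * q\<^sub>2"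
      using assms(6) by (rule system_invariant_imp)
    then show "a + b = real CARD('n) - 2 * real l"
      unfolding ab by (simp add: m_def)
  next
    assume "a + b = real CARD('n) - 2 * real l"
    then show "system_invariant TYPE('n) l t q\<^sub>1 q\<^sub>2 a b"
      by (intro system_invariant_if) (simp_all add: ab m_def)
  qed
  moreover have "a + b = m * (1 / (q\<^sub>1 + 1) + 1 / (q\<^sub>2 + 1))"
    by (simp add: a_def b_def distrib_left)
  ultimately show ?thesis
    using m unfolding inv m_def[symmetric] by (simp add: field_simps)
qed

end
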